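(* Let $\mathcal G$ and $\mathcal K$ be categorical Lie groups, and let $\pi_{\mathbf P}:\mathbf P\to\mathbf M$ and $\pi_{\mathbf Q}:\mathbf Q\to\mathbf M$ be, respectively, a categorical principal $\mathcal G$-bundle and a categorical principal $\mathcal K$-bundle over the same base category $\mathbf M$. Suppose $\mathbb S:\mathbf P\to\mathbf Q$ and $S:\mathcal G\to\mathcal K$ are functors satisfying $$\mathbb S(pg)=\mathbb S(p)S(g),\qquad \mathbb S(\tilde\gamma\phi)=\mathbb S(\tilde\gamma)S(\phi),\qquad \pi_{\mathbf Q}\bigl(\mathbb S(p)\bigr)=\pi_{\mathbf P}(p)$$ for all $p\in\mathrm{Obj}(\mathbf P)$, $g\in\mathrm{Obj}(\mathcal G)$, $\tilde\gamma\in\mathrm{Mor}(\mathbf P)$ and $\phi\in\mathrm{Mor}(\mathcal G)$. Let $\tau_{\mathbf P}$ be a categorical connection on $\mathbf P$. For any $\gamma\in\mathrm{Mor}(\mathbf M)$ and any $q\in\mathrm{Obj}(\mathbf Q)$ on the $\mathbf Q$-fiber over the source $s(\gamma)$, let $$\tau_{\mathbf Q}(\gamma,q):=\mathbb S\bigl(\tau_{\mathbf P}(\gamma,p)\bigr)\,1_{k_{p,q}},$$ where $p\in\mathrm{Obj}(\mathbf P)$ is any point on the $\mathbf P$-fiber over $s(\gamma)$ and $k_{p,q}\in\mathrm{Obj}(\mathcal K)$ is specified by requiring that $q=\mathbb S(p)k_{p,q}$. Then $\tau_{\mathbf Q}$ satisfies the following conditions: (CC1) $\tau_{\mathbf Q}(1_u,q)=1_q$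 whenever $u=\pi_{\mathbf Q}(q)$; (CC2) $\tau_{\mathbf Q}(\gamma,qk)=\tau_{\mathbf Q}(\gamma,q)1_k$ for all $k\in\mathrm{Obj}(\mathcal K)$; (CC3) if $\gamma,\delta\in\mathrm{Mor}(\mathbf M)$ are such that $\delta\circ\gamma$ is defined, then $\tau_{\mathbf Q}(\delta\circ\gamma,q)=\tau_{\mathbf Q}\bigl(\delta,t(\tau_{\mathbf Q}(\gamma,q))\bigr)\circ\tau_{\mathbf Q}(\gamma,q)$.
   Context: **Categorical Lie groups.** A categorical group is a category $\mathcal G$ with a functor $\mathcal G\times\mathcal G\to\mathcal G$ making both $\mathrm{Obj}(\mathcal G)$ and $\mathrm{Mor}(\mathcal G)$ groups. It is a categorical Lie group if both are Lie groups and source $s$, target $t$ and the identity-assigning map $a\mapsto1_a$ are smooth. **Categorical principal bundles.** A categorical space is a category whose object and morphism sets carry smooth (diffeological) space structures for which source, target, identity-assignment and composition are smooth. A categorical principal bundle with structure categorical Lie group $\mathcal G$ consists of categorical spaces $\mathbf P,\mathbf M$, a functor $\pi:\mathbf P\to\mathbf M$ that is smooth and surjective on objects and on morphisms, and a functor $\mathbf P\times\mathcal G\to\mathbf P$ that is a free smooth right action on objects and on morphisms, with $\pi(pg)=\pi(p)$ for all objects/morphisms. It is assumed throughout that $\mathrm{Obj}(\mathbf P)$ and $\mathrm{Obj}(\mathbf M)$ are smooth manifolds and that $\mathrm{Obj}(\mathbf P)\to\mathrm{Obj}(\mathbf M)$ is a (classical) principal $\mathrm{Obj}(\mathcal G)$-bundle.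 **Categorical connections.** A categorical connection on $\pi:\mathbf P\to\mathbf M$ assigns to each $\gamma\in\mathrm{Mor}(\mathbf M)$ and each $p\in\mathrm{Obj}(\mathbf P)$ with $\pi(p)=s(\gamma)$ a morphism $\tau_{\mathbf P}(\gamma,p)\in\mathrm{Mor}(\mathbf P)$ with source $p$ and $\pi$-projection $\gamma$, depending smoothly on $(\gamma,p)$, such that: (CC1) $\tau_{\mathbf P}(1_u,p)=1_p$ for $u=\pi(p)$; (CC2) $\tau_{\mathbf P}(\gamma,pg)=\tau_{\mathbf P}(\gamma,p)1_g$ for all $g\in\mathrm{Obj}(\mathcal G)$; (CC3) $\tau_{\mathbf P}(\delta\circ\gamma,p)=\tau_{\mathbf P}(\delta,t(\tau_{\mathbf P}(\gamma,p)))\circ\tau_{\mathbf P}(\gamma,p)$ whenever $\delta\circ\gamma$ is defined. *)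

theory Defs
  imports "HOL-Analysis.Analysis" "HOL-Algebra.Group"
begin

section \<open>Smooth maps between open subsets of Euclidean spaces\<close>

text \<open>
  Points of \<^term>\<open>Euclidean_space n\<close> are sequences vanishing from index \<open>n\<close> on, so that all
  dimensions live in one type and may be quantified over.
\<close>

primrec Ck_on :: "nat \<Rightarrow> nat \<Rightarrow> (nat \<Rightarrow> real) set \<Rightarrow> ((nat \<Rightarrow> real) \<Rightarrow> real) \<Rightarrow> bool" where
  "Ck_on 0 n U f \<longleftrightarrow> continuous_map (subtopology (Euclidean_space n) U) euclideanreal f"
| "Ck_on (Suc k) n U f \<longleftrightarrow>
     continuous_map (subtopology (Euclidean_space n) U) euclideanreal f \<and>
     (\<forall>i<n. \<exists>g. (\<forall>x\<in>U. ((\<lambda>t. f (x(i := t))) has_real_derivative g x) (at (x i))) \<and> Ck_on k n U g)"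

definition smooth_eucl ::
  "nat \<Rightarrow> (nat \<Rightarrow> real) set \<Rightarrow> nat \<Rightarrow> (nat \<Rightarrow> real) set \<Rightarrow> ((nat \<Rightarrow> real) \<Rightarrow> nat \<Rightarrow> real) \<Rightarrow> bool" where
  "smooth_eucl m V n U h \<longleftrightarrow>
     openin (Euclidean_space m) V \<and> openin (Euclidean_space n) U \<and> h ` V \<subseteq> U \<and>
     (\<forall>i<n. \<forall>k. Ck_on k m V (\<lambda>x. h x i))"

section \<open>Diffeological spaces\<close>

text \<open>
  \<open>D n U p\<close> reads: the restriction of \<open>p\<close> to the open set \<open>U\<close> of \<open>n\<close>-dimensional Euclidean
  space is a plot. As HOL functions are total, plots must not depend on values outside \<open>U\<close>;
  this is the second clause of \<open>diffeology_on\<close>.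
\<close>

type_synonym 'a diffeology = "nat \<Rightarrow> (nat \<Rightarrow> real) set \<Rightarrow> ((nat \<Rightarrow> real) \<Rightarrow> 'a) \<Rightarrow> bool"

definition diffeology_on :: "'a set \<Rightarrow> 'a diffeology \<Rightarrow> bool" where
  "diffeology_on X D \<longleftrightarrow>
     (\<forall>n U p. D n U p \<longrightarrow> openin (Euclidean_space n) U \<and> p ` U \<subseteq> X) \<and>
     (\<forall>n U p q. D n U p \<longrightarrow> (\<forall>x\<in>U. p x = q x) \<longrightarrow> D n U q) \<and>
     (\<forall>n U c. openin (Euclidean_space n) U \<longrightarrow> c \<in> X \<longrightarrow> D n U (\<lambda>_. c)) \<and>
     (\<forall>n U p. openin (Euclidean_space n) U \<longrightarrow> (\<forall>x\<in>U. \<exists>V. x \<in> V \<and> V \<subseteq> U \<and> D n V p)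
        \<longrightarrow> D n U p) \<and>
     (\<forall>m V n U h p. D n U p \<longrightarrow> smooth_eucl m V n U h \<longrightarrow> D m V (p \<circ> h))"

definition smooth_map :: "'a set \<Rightarrow> 'a diffeology \<Rightarrow> 'b set \<Rightarrow> 'b diffeology \<Rightarrow> ('a \<Rightarrow> 'b) \<Rightarrow> bool" where
  "smooth_map X D Y E f \<longleftrightarrow> f ` X \<subseteq> Y \<and> (\<forall>n U p. D n U p \<longrightarrow> E n U (f \<circ> p))"

definition diffeomorphism ::
  "'a set \<Rightarrow> 'a diffeology \<Rightarrow> 'b set \<Rightarrow> 'b diffeology \<Rightarrow> ('a \<Rightarrow> 'b) \<Rightarrow> bool" where
  "diffeomorphism X D Y E f \<longleftrightarrow>
     bij_betw f X Y \<and> smooth_map X D Y E f \<and> smooth_map Y E X D (inv_into X f)"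

definition subset_diffeology :: "'a set \<Rightarrow> 'a diffeology \<Rightarrow> 'a diffeology" where
  "subset_diffeology A D = (\<lambda>n U p. D n U p \<and> p ` U \<subseteq> A)"

definition prod_diffeology :: "'a diffeology \<Rightarrow> 'b diffeology \<Rightarrow> ('a \<times> 'b) diffeology" where
  "prod_diffeology D E = (\<lambda>n U p. D n U (fst \<circ> p) \<and> E n U (snd \<circ> p))"

definition eucl_diffeology :: "nat \<Rightarrow> (nat \<Rightarrow> real) diffeology" where
  "eucl_diffeology n = (\<lambda>m U p. smooth_eucl m U n (topspace (Euclidean_space n)) p)"

definition D_open :: "'a set \<Rightarrow> 'a diffeology \<Rightarrow> 'a set \<Rightarrow> bool" where
  "D_open X D A \<longleftrightarrow>
     A \<subseteq> X \<and> (\<forall>n U p. D n U p \<longrightarrow> openin (Euclidean_space n) {x \<in> U. p x \<in> A})"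

definition D_topology :: "'a set \<Rightarrow> 'a diffeology \<Rightarrow> 'a topology" where
  "D_topology X D = topology (D_open X D)"

lemma istopology_D_open: "istopology (D_open X D)"
  unfolding istopology_def
proof (intro conjI allI impI)
  fix S T assume ST: "D_open X D S" "D_open X D T"
  have "openin (Euclidean_space n) {x \<in> U. p x \<in> S \<inter> T}" if "D n U p" for n U p
  proof -
    have "{x \<in> U. p x \<in> S \<inter> T} = {x \<in> U. p x \<in> S} \<inter> {x \<in> U. p x \<in> T}"
      by auto
    moreover have "openin (Euclidean_space n) {x \<in> U. p x \<in> S}"
      using ST(1) that unfolding D_open_def by blast
    moreover have "openin (Euclidean_space n) {x \<in> U. p x \<in> T}"
      using ST(2) that unfolding D_open_def by blast
    ultimately show ?thesis
      by (simp only: openin_Int)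
  qed
  then show "D_open X D (S \<inter> T)"
    using ST unfolding D_open_def by blast
next
  fix \<K> assume K: "\<forall>K\<in>\<K>. D_open X D K"
  have "openin (Euclidean_space n) {x \<in> U. p x \<in> \<Union>\<K>}" if "D n U p" for n U p
  proof -
    have "{x \<in> U. p x \<in> \<Union>\<K>} = \<Union>((\<lambda>K. {x \<in> U. p x \<in> K}) ` \<K>)"
      by auto
    also have "openin (Euclidean_space n) \<dots>"
      using K that unfolding D_open_def by (intro openin_Union) blast
    finally show ?thesis .
  qed
  then show "D_open X D (\<Union>\<K>)"
    using K unfolding D_open_def by blast
qed

lemma openin_D_topology: "openin (D_topology X D) A \<longleftrightarrow> D_open X D A"
  unfolding D_topology_def topology_inverse'[OF istopology_D_open] ..

section \<open>Manifolds, Lie groups and principal bundles\<close>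

text \<open>
  A smooth manifold is a diffeological space locally diffeomorphic to a fixed Euclidean space,
  with Hausdorff and second countable D-topology. Between such spaces, the diffeologically
  smooth maps are the usual smooth maps.
\<close>

definition smooth_manifold :: "'a set \<Rightarrow> 'a diffeology \<Rightarrow> bool" where
  "smooth_manifold X D \<longleftrightarrow>
     diffeology_on X D \<and>
     Hausdorff_space (D_topology X D) \<and>
     (\<exists>\<B>. countable \<B> \<and> openin (D_topology X D) = arbitrary union_of (\<lambda>V. V \<in> \<B>)) \<and>
     (\<exists>n. \<forall>x\<in>X. \<exists>A W \<phi>. x \<in> A \<and> openin (D_topology X D) A \<and> openin (Euclidean_space n) W \<and>
        diffeomorphism A (subset_diffeology A D) W (subset_diffeology W (eucl_diffeology n)) \<phi>)"

definition lie_group :: "'g monoid \<Rightarrow> 'g diffeology \<Rightarrow> bool" where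
  "lie_group H D \<longleftrightarrow>
     group H \<and> smooth_manifold (carrier H) D \<and>
     smooth_map (carrier H \<times> carrier H) (prod_diffeology D D) (carrier H) D (\<lambda>(a, b). a \<otimes>\<^bsub>H\<^esub> b) \<and>
     smooth_map (carrier H) D (carrier H) D (m_inv H)"

definition free_right_action :: "'g monoid \<Rightarrow> 'a set \<Rightarrow> ('a \<Rightarrow> 'g \<Rightarrow> 'a) \<Rightarrow> bool" where
  "free_right_action H X act \<longleftrightarrow>
     (\<forall>x\<in>X. \<forall>g\<in>carrier H. act x g \<in> X) \<and>
     (\<forall>x\<in>X. act x \<one>\<^bsub>H\<^esub> = x) \<and>
     (\<forall>x\<in>X. \<forall>g\<in>carrier H. \<forall>h\<in>carrier H. act (act x g) h = act x (g \<otimes>\<^bsub>H\<^esub> h)) \<and>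
     (\<forall>x\<in>X. \<forall>g\<in>carrier H. act x g = x \<longrightarrow> g = \<one>\<^bsub>H\<^esub>)"

definition smooth_action ::
  "'g monoid \<Rightarrow> 'g diffeology \<Rightarrow> 'a set \<Rightarrow> 'a diffeology \<Rightarrow> ('a \<Rightarrow> 'g \<Rightarrow> 'a) \<Rightarrow> bool" where
  "smooth_action H DH X D act \<longleftrightarrow>
     smooth_map (X \<times> carrier H) (prod_diffeology D DH) X D (\<lambda>(x, g). act x g)"

definition principal_bundle ::
  "'a set \<Rightarrow> 'a diffeology \<Rightarrow> 'b set \<Rightarrow> 'b diffeology \<Rightarrow> 'g monoid \<Rightarrow> 'g diffeology
    \<Rightarrow> ('a \<Rightarrow> 'b) \<Rightarrow> ('a \<Rightarrow> 'g \<Rightarrow> 'a) \<Rightarrow> bool" where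
  "principal_bundle X D B DB H DH \<pi> act \<longleftrightarrow>
     smooth_manifold X D \<and> smooth_manifold B DB \<and> lie_group H DH \<and>
     smooth_map X D B DB \<pi> \<and> \<pi> ` X = B \<and>
     free_right_action H X act \<and> smooth_action H DH X D act \<and>
     (\<forall>x\<in>X. \<forall>g\<in>carrier H. \<pi> (act x g) = \<pi> x) \<and>
     (\<forall>b\<in>B. \<exists>W \<phi>. b \<in> W \<and> openin (D_topology B DB) W \<and>
        diffeomorphism
          (W \<times> carrier H) (prod_diffeology (subset_diffeology W DB) DH)
          {x \<in> X. \<pi> x \<in> W} (subset_diffeology {x \<in> X. \<pi> x \<in> W} D) \<phi> \<and>
        (\<forall>w\<in>W. \<forall>g\<in>carrier H. \<pi> (\<phi> (w, g)) = w) \<and>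
        (\<forall>w\<in>W. \<forall>g\<in>carrier H. \<forall>h\<in>carrier H. \<phi> (w, g \<otimes>\<^bsub>H\<^esub> h) = act (\<phi> (w, g)) h))"

section \<open>Categories, categorical spaces and categorical Lie groups\<close>

record ('o, 'm) cat =
  Obj :: "'o set"
  Mor :: "'m set"
  src :: "'m \<Rightarrow> 'o"
  tgt :: "'m \<Rightarrow> 'o"
  ident :: "'o \<Rightarrow> 'm"
  ccomp :: "'m \<Rightarrow> 'm \<Rightarrow> 'm"

text \<open>\<open>ccomp C g f\<close> is the composite "g after f", meaningful when \<open>src C g = tgt C f\<close>.\<close>

definition is_category :: "('o, 'm, 'z) cat_scheme \<Rightarrow> bool" where
  "is_category C \<longleftrightarrow>
     (\<forall>f\<in>Mor C. src C f \<in> Obj C \<and> tgt C f \<in> Obj C) \<and>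
     (\<forall>a\<in>Obj C. ident C a \<in> Mor C \<and> src C (ident C a) = a \<and> tgt C (ident C a) = a) \<and>
     (\<forall>g\<in>Mor C. \<forall>f\<in>Mor C. src C g = tgt C f \<longrightarrow>
        ccomp C g f \<in> Mor C \<and> src C (ccomp C g f) = src C f \<and> tgt C (ccomp C g f) = tgt C g) \<and>
     (\<forall>f\<in>Mor C. ccomp C f (ident C (src C f)) = f \<and> ccomp C (ident C (tgt C f)) f = f) \<and>
     (\<forall>h\<in>Mor C. \<forall>g\<in>Mor C. \<forall>f\<in>Mor C. src C h = tgt C g \<longrightarrow> src C g = tgt C f \<longrightarrow>
        ccomp C h (ccomp C g f) = ccomp C (ccomp C h g) f)"

definition is_functor ::
  "('o, 'm, 'z) cat_scheme \<Rightarrow> ('p, 'n, 'y) cat_scheme \<Rightarrow> ('o \<Rightarrow> 'p) \<Rightarrow> ('m \<Rightarrow> 'n) \<Rightarrow> bool" where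
  "is_functor C D Fo Fm \<longleftrightarrow>
     (\<forall>a\<in>Obj C. Fo a \<in> Obj D) \<and>
     (\<forall>f\<in>Mor C. Fm f \<in> Mor D \<and> src D (Fm f) = Fo (src C f) \<and> tgt D (Fm f) = Fo (tgt C f)) \<and>
     (\<forall>a\<in>Obj C. Fm (ident C a) = ident D (Fo a)) \<and>
     (\<forall>g\<in>Mor C. \<forall>f\<in>Mor C. src C g = tgt C f \<longrightarrow> Fm (ccomp C g f) = ccomp D (Fm g) (Fm f))"

definition prod_cat ::
  "('o, 'm, 'z) cat_scheme \<Rightarrow> ('p, 'n, 'y) cat_scheme \<Rightarrow> ('o \<times> 'p, 'm \<times> 'n) cat" where
  "prod_cat C D =
     \<lparr>Obj = Obj C \<times> Obj D, Mor = Mor C \<times> Mor D,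
      src = map_prod (src C) (src D), tgt = map_prod (tgt C) (tgt D),
      ident = map_prod (ident C) (ident D),
      ccomp = (\<lambda>(g, k) (f, h). (ccomp C g f, ccomp D k h))\<rparr>"

record ('o, 'm) cat_space = "('o, 'm) cat" +
  objD :: "'o diffeology"
  morD :: "'m diffeology"

definition categorical_space :: "('o, 'm, 'z) cat_space_scheme \<Rightarrow> bool" where
  "categorical_space C \<longleftrightarrow>
     is_category C \<and> diffeology_on (Obj C) (objD C) \<and> diffeology_on (Mor C) (morD C) \<and>
     smooth_map (Mor C) (morD C) (Obj C) (objD C) (src C) \<and>
     smooth_map (Mor C) (morD C) (Obj C) (objD C) (tgt C) \<and>
     smooth_map (Obj C) (objD C) (Mor C) (morD C) (ident C) \<and>
     (let R = {(g, f) \<in> Mor C \<times> Mor C. src C g = tgt C f} in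
        smooth_map R (subset_diffeology R (prod_diffeology (morD C) (morD C)))
          (Mor C) (morD C) (\<lambda>(g, f). ccomp C g f))"

record ('o, 'm) cat_group = "('o, 'm) cat_space" +
  objG :: "'o monoid"
  morG :: "'m monoid"

definition categorical_group :: "('o, 'm, 'z) cat_group_scheme \<Rightarrow> bool" where
  "categorical_group G \<longleftrightarrow>
     is_category G \<and>
     group (objG G) \<and> carrier (objG G) = Obj G \<and>
     group (morG G) \<and> carrier (morG G) = Mor G \<and>
     is_functor (prod_cat G G) G (\<lambda>(a, b). a \<otimes>\<^bsub>objG G\<^esub> b) (\<lambda>(\<phi>, \<psi>). \<phi> \<otimes>\<^bsub>morG G\<^esub> \<psi>)"

definition categorical_lie_group :: "('o, 'm, 'z) cat_group_scheme \<Rightarrow> bool" where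
  "categorical_lie_group G \<longleftrightarrow>
     categorical_group G \<and> lie_group (objG G) (objD G) \<and> lie_group (morG G) (morD G) \<and>
     smooth_map (Mor G) (morD G) (Obj G) (objD G) (src G) \<and>
     smooth_map (Mor G) (morD G) (Obj G) (objD G) (tgt G) \<and>
     smooth_map (Obj G) (objD G) (Mor G) (morD G) (ident G)"

section \<open>Categorical principal bundles and categorical connections\<close>

text \<open>
  The record of a bundle is its total category together with the projection to a base
  (objects \<open>'mo\<close>, morphisms \<open>'mm\<close>) and the action of a structure group (objects \<open>'go\<close>,
  morphisms \<open>'gm\<close>).
\<close>

record ('po, 'pm, 'mo, 'mm, 'go, 'gm) cat_bundle = "('po, 'pm) cat_space" +
  projO :: "'po \<Rightarrow> 'mo"
  projM :: "'pm \<Rightarrow> 'mm"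
  actO :: "'po \<Rightarrow> 'go \<Rightarrow> 'po"
  actM :: "'pm \<Rightarrow> 'gm \<Rightarrow> 'pm"

definition categorical_principal_bundle ::
  "('po, 'pm, 'mo, 'mm, 'go, 'gm) cat_bundle \<Rightarrow> ('mo, 'mm) cat_space \<Rightarrow> ('go, 'gm) cat_group
    \<Rightarrow> bool" where
  "categorical_principal_bundle P M G \<longleftrightarrow>
     categorical_lie_group G \<and> categorical_space P \<and> categorical_space M \<and>
     is_functor P M (projO P) (projM P) \<and>
     smooth_map (Obj P) (objD P) (Obj M) (objD M) (projO P) \<and> projO P ` Obj P = Obj M \<and>
     smooth_map (Mor P) (morD P) (Mor M) (morD M) (projM P) \<and> projM P ` Mor P = Mor M \<and>
     is_functor (prod_cat P G) P (\<lambda>(p, g). actO P p g) (\<lambda>(f, \<phi>). actM P f \<phi>) \<and>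
     free_right_action (objG G) (Obj P) (actO P) \<and>
     smooth_action (objG G) (objD G) (Obj P) (objD P) (actO P) \<and>
     free_right_action (morG G) (Mor P) (actM P) \<and>
     smooth_action (morG G) (morD G) (Mor P) (morD P) (actM P) \<and>
     (\<forall>p\<in>Obj P. \<forall>g\<in>Obj G. projO P (actO P p g) = projO P p) \<and>
     (\<forall>f\<in>Mor P. \<forall>\<phi>\<in>Mor G. projM P (actM P f \<phi>) = projM P f) \<and>
     principal_bundle (Obj P) (objD P) (Obj M) (objD M) (objG G) (objD G) (projO P) (actO P)"

definition categorical_connection ::
  "('po, 'pm, 'mo, 'mm, 'go, 'gm) cat_bundle \<Rightarrow> ('mo, 'mm) cat_space \<Rightarrow> ('go, 'gm) cat_group
    \<Rightarrow> ('mm \<Rightarrow> 'po \<Rightarrow> 'pm) \<Rightarrow> bool" where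
  "categorical_connection P M G \<tau> \<longleftrightarrow>
     (\<forall>\<gamma>\<in>Mor M. \<forall>p\<in>Obj P. projO P p = src M \<gamma> \<longrightarrow>
        \<tau> \<gamma> p \<in> Mor P \<and> src P (\<tau> \<gamma> p) = p \<and> projM P (\<tau> \<gamma> p) = \<gamma>) \<and>
     (let R = {(\<gamma>, p) \<in> Mor M \<times> Obj P. projO P p = src M \<gamma>} in
        smooth_map R (subset_diffeology R (prod_diffeology (morD M) (objD P)))
          (Mor P) (morD P) (\<lambda>(\<gamma>, p). \<tau> \<gamma> p)) \<and>
     (\<forall>p\<in>Obj P. \<tau> (ident M (projO P p)) p = ident P p) \<and>
     (\<forall>\<gamma>\<in>Mor M. \<forall>p\<in>Obj P. projO P p = src M \<gamma> \<longrightarrow>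
        (\<forall>g\<in>Obj G. \<tau> \<gamma> (actO P p g) = actM P (\<tau> \<gamma> p) (ident G g))) \<and>
     (\<forall>\<gamma>\<in>Mor M. \<forall>\<delta>\<in>Mor M. \<forall>p\<in>Obj P. projO P p = src M \<gamma> \<longrightarrow> src M \<delta> = tgt M \<gamma> \<longrightarrow>
        \<tau> (ccomp M \<delta> \<gamma>) p = ccomp P (\<tau> \<delta> (tgt P (\<tau> \<gamma> p))) (\<tau> \<gamma> p))"

text \<open>
  The element \<open>k\<close> of the structure group with \<open>q = x k\<close>, for \<open>x\<close> and \<open>q\<close> in the same fiber.
\<close>

definition fiber_translation ::
  "('qo, 'qm, 'mo, 'mm, 'ko, 'km) cat_bundle \<Rightarrow> ('ko, 'km) cat_group \<Rightarrow> 'qo \<Rightarrow> 'qo \<Rightarrow> 'ko" where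
  "fiber_translation Q K x q = (THE k. k \<in> Obj K \<and> q = actO Q x k)"

text \<open>
  The point \<open>p\<close> of the fiber is an arbitrary one; here it is picked by choice.
\<close>

definition pushforward_transport ::
  "('po, 'pm, 'mo, 'mm, 'go, 'gm) cat_bundle \<Rightarrow> ('mo, 'mm) cat_space
    \<Rightarrow> ('qo, 'qm, 'mo, 'mm, 'ko, 'km) cat_bundle \<Rightarrow> ('ko, 'km) cat_group
    \<Rightarrow> ('po \<Rightarrow> 'qo) \<Rightarrow> ('pm \<Rightarrow> 'qm) \<Rightarrow> ('mm \<Rightarrow> 'po \<Rightarrow> 'pm) \<Rightarrow> 'mm \<Rightarrow> 'qo \<Rightarrow> 'qm" where
  "pushforward_transport P M Q K \<SS>o \<SS>m \<tau> \<gamma> q =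
     (let p = (SOME p. p \<in> Obj P \<and> projO P p = src M \<gamma>);
          k = fiber_translation Q K (\<SS>o p) q
      in actM Q (\<SS>m (\<tau> \<gamma> p)) (ident K k))"

end

theory Submission
  imports Defs
begin

text \<open>
  Write \<open>\<tau>\<^bsub>p,k\<^esub>(\<gamma>) = \<SS>(\<tau>\<^sub>P(\<gamma>, p)) 1\<^sub>k\<close> for a point \<open>p\<close> of the fiber of \<open>P\<close> over the source of \<open>\<gamma>\<close> and an
  object \<open>k\<close> of \<open>K\<close>. Each such morphism satisfies the connection laws almost verbatim, because both
  \<open>\<SS>\<close> and the action of \<open>K\<close> are functors: it starts at \<open>\<SS>(p) k\<close>; it is an identity when \<open>\<gamma>\<close> is one;
  and since \<open>1\<^sub>k = 1\<^sub>k \<circ> 1\<^sub>k\<close>, the interchange law splits \<open>\<SS>(\<tau>\<^sub>P(\<delta> \<circ> \<gamma>, p)) 1\<^sub>k\<close> into two factors with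
  the same \<open>k\<close>. Acting by a further \<open>1\<^sub>l\<close> replaces \<open>k\<close> by \<open>k l\<close>, because \<open>k \<mapsto> 1\<^sub>k\<close> is multiplicative.

  What has to be shown is that \<open>\<tau>\<^bsub>p,k\<^esub>(\<gamma>)\<close> depends only on \<open>q = \<SS>(p) k\<close>. The fibers of a principal
  bundle are torsors (\<open>principal_bundle_fiber_torsor\<close>), so another pair \<open>(p', k')\<close> with the same \<open>q\<close>
  has \<open>p' = p g\<close> and then \<open>k = S(g) k'\<close>; equivariance of \<open>\<tau>\<^sub>P\<close> and of \<open>\<SS>\<close>, together with
  \<open>S(1\<^sub>g) = 1\<^bsub>S(g)\<^esub>\<close>, gives
  \<open>\<SS>(\<tau>\<^sub>P(\<gamma>, p g)) 1\<^bsub>k'\<^esub> = \<SS>(\<tau>\<^sub>P(\<gamma>, p)) 1\<^bsub>S(g)\<^esub> 1\<^bsub>k'\<^esub> = \<SS>(\<tau>\<^sub>P(\<gamma>, p)) 1\<^sub>k\<close>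
  (\<open>lift_independent\<close>). Hence \<open>\<tau>\<^sub>Q(\<gamma>, q)\<close> may be computed from whichever pair \<open>(p, k)\<close> suits the law
  at hand (\<open>pushforward_transport_eq\<close>).
\<close>

section \<open>Fibers of principal bundles are torsors\<close>

text \<open>
  In a local trivialization the fiber over \<open>b\<close> is a copy of the group on which the group acts by right
  multiplication, so the point with coordinate \<open>g\<close> is carried to the one with coordinate \<open>h\<close> by
  \<open>g\<^sup>-\<^sup>1 h\<close>. Uniqueness is freeness of the action.
\<close>

lemma principal_bundle_fiber_torsor:
  assumes PB: "principal_bundle X D B DB H DH \<pi> act"
    and x: "x \<in> X" and y: "y \<in> X" and xy: "\<pi> x = \<pi> y"
  shows "\<exists>!g. g \<in> carrier H \<and> y = act x g"
proof -
  have H: "group H" and free: "free_right_action H X act" and "\<pi> x \<in> B"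
    using PB x unfolding principal_bundle_def lie_group_def by auto
  interpret H: group H by (rule H)
  have "\<exists>W \<phi>. \<pi> x \<in> W \<and> bij_betw \<phi> (W \<times> carrier H) {x \<in> X. \<pi> x \<in> W} \<and>
      (\<forall>w\<in>W. \<forall>g\<in>carrier H. \<pi> (\<phi> (w, g)) = w) \<and>
      (\<forall>w\<in>W. \<forall>g\<in>carrier H. \<forall>h\<in>carrier H. \<phi> (w, g \<otimes>\<^bsub>H\<^esub> h) = act (\<phi> (w, g)) h)"
    using PB \<open>\<pi> x \<in> B\<close> unfolding principal_bundle_def diffeomorphism_def
    by (elim conjE) (drule (1) bspec, elim exE conjE, intro exI conjI, assumption+)
  then obtain W \<phi> where W: "\<pi> x \<in> W"
    and bij: "bij_betw \<phi> (W \<times> carrier H) {x \<in> X. \<pi> x \<in> W}"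
    and proj: "\<And>w g. w \<in> W \<Longrightarrow> g \<in> carrier H \<Longrightarrow> \<pi> (\<phi> (w, g)) = w"
    and equiv: "\<And>w g h. w \<in> W \<Longrightarrow> g \<in> carrier H \<Longrightarrow> h \<in> carrier H \<Longrightarrow>
                  \<phi> (w, g \<otimes>\<^bsub>H\<^esub> h) = act (\<phi> (w, g)) h"
    by blast
  have coord: "\<exists>g\<in>carrier H. z = \<phi> (\<pi> x, g)" if "z \<in> X" "\<pi> z = \<pi> x" for z
  proof -
    have "z \<in> \<phi> ` (W \<times> carrier H)"
      using bij that W unfolding bij_betw_def by auto
    then show ?thesis using proj that by force
  qed
  obtain g where g: "g \<in> carrier H" "x = \<phi> (\<pi> x, g)" using coord x by blast
  obtain h where h: "h \<in> carrier H" "y = \<phi> (\<pi> x, h)" using coord y xy by metis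
  have "y = act x (inv\<^bsub>H\<^esub> g \<otimes>\<^bsub>H\<^esub> h)"
  proof -
    have "g \<otimes>\<^bsub>H\<^esub> (inv\<^bsub>H\<^esub> g \<otimes>\<^bsub>H\<^esub> h) = h"
      using g(1) h(1) by (simp flip: H.m_assoc)
    moreover have "inv\<^bsub>H\<^esub> g \<otimes>\<^bsub>H\<^esub> h \<in> carrier H" using g(1) h(1) by simp
    ultimately show ?thesis using equiv[OF W g(1)] g(2) h(2) by metis
  qed
  moreover have "a = b" if "a \<in> carrier H" "b \<in> carrier H" "act x a = act x b" for a b
  proof -
    have "act x (a \<otimes>\<^bsub>H\<^esub> inv\<^bsub>H\<^esub> b) = act (act x b) (inv\<^bsub>H\<^esub> b)"
      using free x that unfolding free_right_action_def by (metis H.inv_closed)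
    also have "\<dots> = x"
      using free x that unfolding free_right_action_def by (metis H.inv_closed H.r_inv)
    finally have "a \<otimes>\<^bsub>H\<^esub> inv\<^bsub>H\<^esub> b = \<one>\<^bsub>H\<^esub>"
      using free x that unfolding free_right_action_def by simp
    then show "a = b" using that by (metis H.inv_equality H.inv_closed H.inv_inv)
  qed
  ultimately show ?thesis
    using g(1) h(1) by (metis H.inv_closed H.m_closed)
qed

section \<open>Identities in categorical groups and bundles\<close>

text \<open>Multiplication is a functor on the product category, whose identities are pairs of identities.\<close>

lemma categorical_group_ident_mult:
  assumes "categorical_group G" and "a \<in> Obj G" "b \<in> Obj G"
  shows "ident G a \<otimes>\<^bsub>morG G\<^esub> ident G b = ident G (a \<otimes>\<^bsub>objG G\<^esub> b)"
proof -
  have "is_functor (prod_cat G G) G (\<lambda>(a, b). a \<otimes>\<^bsub>objG G\<^esub> b) (\<lambda>(\<phi>, \<psi>). \<phi> \<otimes>\<^bsub>morG G\<^esub> \<psi>)"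
    using assms(1) unfolding categorical_group_def by blast
  then show ?thesis
    using assms(2,3) unfolding is_functor_def prod_cat_def by auto
qed

text \<open>
  The action is likewise a functor on a product category; its preservation of composites is the
  interchange law \<open>(g \<circ> f)(\<psi> \<circ> \<phi>) = g \<psi> \<circ> f \<phi>\<close>. Its instance \<open>\<psi> = \<phi> = 1\<^sub>k\<close>
  (\<open>actM_ccomp_ident\<close>) says that acting by \<open>1\<^sub>k\<close> distributes over composition.
\<close>

context
  fixes Q :: "('qo, 'qm, 'mo, 'mm, 'ko, 'km) cat_bundle"
    and M :: "('mo, 'mm) cat_space" and K :: "('ko, 'km) cat_group"
  assumes Q: "categorical_principal_bundle Q M K"
begin

lemma bundle_categories:
  shows "is_category Q" "is_category M" "is_category K" "categorical_group K"
    "is_functor Q M (projO Q) (projM Q)"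
  using Q unfolding categorical_principal_bundle_def categorical_space_def
    categorical_lie_group_def categorical_group_def by blast+

lemma bundle_groups:
  shows "group (objG K)" "carrier (objG K) = Obj K" "carrier (morG K) = Mor K"
  using bundle_categories(4) unfolding categorical_group_def by blast+

lemma ident_in_Mor: "k \<in> Obj K \<Longrightarrow> ident K k \<in> Mor K"
  using bundle_categories(3) unfolding is_category_def by blast

lemma ident_src_tgt: "k \<in> Obj K \<Longrightarrow> src K (ident K k) = k" "k \<in> Obj K \<Longrightarrow> tgt K (ident K k) = k"
  using bundle_categories(3) unfolding is_category_def by blast+

lemma bundle_action_functor:
  "is_functor (prod_cat Q K) Q (\<lambda>(p, g). actO Q p g) (\<lambda>(f, \<phi>). actM Q f \<phi>)"
  using Q unfolding categorical_principal_bundle_def by blast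

lemma actO_closed: "x \<in> Obj Q \<Longrightarrow> k \<in> Obj K \<Longrightarrow> actO Q x k \<in> Obj Q"
  using bundle_action_functor unfolding is_functor_def prod_cat_def by auto

lemma actM_closed: "f \<in> Mor Q \<Longrightarrow> \<phi> \<in> Mor K \<Longrightarrow> actM Q f \<phi> \<in> Mor Q"
  using bundle_action_functor unfolding is_functor_def prod_cat_def by auto

lemma actO_actO:
  "x \<in> Obj Q \<Longrightarrow> k \<in> Obj K \<Longrightarrow> l \<in> Obj K \<Longrightarrow>
    actO Q (actO Q x k) l = actO Q x (k \<otimes>\<^bsub>objG K\<^esub> l)"
  using Q bundle_groups unfolding categorical_principal_bundle_def free_right_action_def by auto

lemma actM_ident_ident:
  assumes "f \<in> Mor Q" "k \<in> Obj K" "l \<in> Obj K"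
  shows "actM Q (actM Q f (ident K k)) (ident K l) = actM Q f (ident K (k \<otimes>\<^bsub>objG K\<^esub> l))"
proof -
  have "actM Q (actM Q f (ident K k)) (ident K l)
      = actM Q f (ident K k \<otimes>\<^bsub>morG K\<^esub> ident K l)"
    using Q assms ident_in_Mor bundle_groups(3)
    unfolding categorical_principal_bundle_def free_right_action_def by auto
  then show ?thesis
    using categorical_group_ident_mult[OF bundle_categories(4)] assms by simp
qed

lemma actM_ident_src_tgt:
  assumes "f \<in> Mor Q" "k \<in> Obj K"
  shows "src Q (actM Q f (ident K k)) = actO Q (src Q f) k"
    and "tgt Q (actM Q f (ident K k)) = actO Q (tgt Q f) k"
  using bundle_action_functor ident_src_tgt ident_in_Mor assms
  unfolding is_functor_def prod_cat_def by auto

lemma actM_ident: "x \<in> Obj Q \<Longrightarrow> k \<in> Obj K \<Longrightarrow> actM Q (ident Q x) (ident K k) = ident Q (actO Q x k)"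
  using bundle_action_functor unfolding is_functor_def prod_cat_def by auto

lemma actM_ccomp_ident:
  assumes "g \<in> Mor Q" "f \<in> Mor Q" "src Q g = tgt Q f" "k \<in> Obj K"
  shows "actM Q (ccomp Q g f) (ident K k)
       = ccomp Q (actM Q g (ident K k)) (actM Q f (ident K k))"
proof -
  have "ccomp K (ident K k) (ident K k) = ident K k"
    using bundle_categories(3) assms(4) unfolding is_category_def by metis
  then show ?thesis
    using bundle_action_functor assms ident_src_tgt ident_in_Mor
    unfolding is_functor_def prod_cat_def by fastforce
qed

lemma projO_actO: "x \<in> Obj Q \<Longrightarrow> k \<in> Obj K \<Longrightarrow> projO Q (actO Q x k) = projO Q x"
  using Q unfolding categorical_principal_bundle_def by blast

lemma bundle_fiber_torsor:
  assumes "x \<in> Obj Q" "y \<in> Obj Q" "projO Q x = projO Q y"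
  shows "\<exists>!k. k \<in> Obj K \<and> y = actO Q x k"
proof -
  have "principal_bundle (Obj Q) (objD Q) (Obj M) (objD M) (objG K) (objD K) (projO Q) (actO Q)"
    using Q unfolding categorical_principal_bundle_def by blast
  from principal_bundle_fiber_torsor[OF this assms] show ?thesis
    by (simp add: bundle_groups)
qed

lemma fiber_nonempty:
  assumes "u \<in> Obj M"
  shows "\<exists>x\<in>Obj Q. projO Q x = u"
proof -
  have "projO Q ` Obj Q = Obj M"
    using Q unfolding categorical_principal_bundle_def by blast
  then show ?thesis using assms by (metis imageE)
qed

end

section \<open>The transport induced by a morphism of bundles\<close>

locale connection_pushforward =
  fixes G :: "('go, 'gm) cat_group"
    and K :: "('ko, 'km) cat_group"
    and M :: "('mo, 'mm) cat_space"
    and P :: "('po, 'pm, 'mo, 'mm, 'go, 'gm) cat_bundle"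
    and Q :: "('qo, 'qm, 'mo, 'mm, 'ko, 'km) cat_bundle"
    and \<SS>o :: "'po \<Rightarrow> 'qo" and \<SS>m :: "'pm \<Rightarrow> 'qm"
    and So :: "'go \<Rightarrow> 'ko" and Sm :: "'gm \<Rightarrow> 'km"
    and \<tau> :: "'mm \<Rightarrow> 'po \<Rightarrow> 'pm"
  assumes P: "categorical_principal_bundle P M G" and Q: "categorical_principal_bundle Q M K"
    and \<SS>: "is_functor P Q \<SS>o \<SS>m" and S: "is_functor G K So Sm"
    and equivariant_obj:
      "\<And>p g. p \<in> Obj P \<Longrightarrow> g \<in> Obj G \<Longrightarrow> \<SS>o (actO P p g) = actO Q (\<SS>o p) (So g)"
    and equivariant_mor:
      "\<And>f \<phi>. f \<in> Mor P \<Longrightarrow> \<phi> \<in> Mor G \<Longrightarrow> \<SS>m (actM P f \<phi>) = actM Q (\<SS>m f) (Sm \<phi>)"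
    and over_base: "\<And>p. p \<in> Obj P \<Longrightarrow> projO Q (\<SS>o p) = projO P p"
    and conn: "categorical_connection P M G \<tau>"
begin

lemma \<SS>_obj: "p \<in> Obj P \<Longrightarrow> \<SS>o p \<in> Obj Q"
  and \<SS>_mor: "f \<in> Mor P \<Longrightarrow> \<SS>m f \<in> Mor Q"
  and \<SS>_src: "f \<in> Mor P \<Longrightarrow> src Q (\<SS>m f) = \<SS>o (src P f)"
  and \<SS>_tgt: "f \<in> Mor P \<Longrightarrow> tgt Q (\<SS>m f) = \<SS>o (tgt P f)"
  and \<SS>_ident: "p \<in> Obj P \<Longrightarrow> \<SS>m (ident P p) = ident Q (\<SS>o p)"
  and \<SS>_ccomp: "g \<in> Mor P \<Longrightarrow> f \<in> Mor P \<Longrightarrow> src P g = tgt P f \<Longrightarrow>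
                  \<SS>m (ccomp P g f) = ccomp Q (\<SS>m g) (\<SS>m f)"
  using \<SS> unfolding is_functor_def by blast+

lemma S_obj: "g \<in> Obj G \<Longrightarrow> So g \<in> Obj K"
  and S_ident: "g \<in> Obj G \<Longrightarrow> Sm (ident G g) = ident K (So g)"
  using S unfolding is_functor_def by blast+

lemma \<tau>_mor: "\<gamma> \<in> Mor M \<Longrightarrow> p \<in> Obj P \<Longrightarrow> projO P p = src M \<gamma> \<Longrightarrow> \<tau> \<gamma> p \<in> Mor P"
  and \<tau>_src: "\<gamma> \<in> Mor M \<Longrightarrow> p \<in> Obj P \<Longrightarrow> projO P p = src M \<gamma> \<Longrightarrow> src P (\<tau> \<gamma> p) = p"
  and \<tau>_proj: "\<gamma> \<in> Mor M \<Longrightarrow> p \<in> Obj P \<Longrightarrow> projO P p = src M \<gamma> \<Longrightarrow> projM P (\<tau> \<gamma> p) = \<gamma>"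
  and \<tau>_ident: "p \<in> Obj P \<Longrightarrow> \<tau> (ident M (projO P p)) p = ident P p"
  and \<tau>_act: "\<gamma> \<in> Mor M \<Longrightarrow> p \<in> Obj P \<Longrightarrow> projO P p = src M \<gamma> \<Longrightarrow> g \<in> Obj G \<Longrightarrow>
                \<tau> \<gamma> (actO P p g) = actM P (\<tau> \<gamma> p) (ident G g)"
  and \<tau>_ccomp: "\<gamma> \<in> Mor M \<Longrightarrow> \<delta> \<in> Mor M \<Longrightarrow> p \<in> Obj P \<Longrightarrow> projO P p = src M \<gamma> \<Longrightarrow>
                src M \<delta> = tgt M \<gamma> \<Longrightarrow>
                \<tau> (ccomp M \<delta> \<gamma>) p = ccomp P (\<tau> \<delta> (tgt P (\<tau> \<gamma> p))) (\<tau> \<gamma> p)"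
  using conn unfolding categorical_connection_def by blast+

lemma \<tau>_tgt:
  assumes "\<gamma> \<in> Mor M" "p \<in> Obj P" "projO P p = src M \<gamma>"
  shows "tgt P (\<tau> \<gamma> p) \<in> Obj P" "projO P (tgt P (\<tau> \<gamma> p)) = tgt M \<gamma>"
  using bundle_categories[OF P] \<tau>_mor[OF assms] \<tau>_proj[OF assms]
  unfolding is_category_def is_functor_def by metis+

lemma fiber_translation_exists:
  assumes "p \<in> Obj P" "q \<in> Obj Q" "projO P p = projO Q q"
  shows "\<exists>!k. k \<in> Obj K \<and> q = actO Q (\<SS>o p) k"
  using bundle_fiber_torsor[OF Q \<SS>_obj] assms over_base by simp

text \<open>
  The relation \<open>p' = p g\<close> moves the factor \<open>S(g)\<close> from the lift into the translation element: \<open>S(g) k'\<close>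
  and \<open>k\<close> both carry \<open>\<SS>(p)\<close> to the same point, so they agree by freeness.
\<close>

lemma lift_independent:
  assumes \<gamma>: "\<gamma> \<in> Mor M"
    and p: "p \<in> Obj P" "projO P p = src M \<gamma>" and p': "p' \<in> Obj P" "projO P p' = src M \<gamma>"
    and k: "k \<in> Obj K" and k': "k' \<in> Obj K"
    and same: "actO Q (\<SS>o p) k = actO Q (\<SS>o p') k'"
  shows "actM Q (\<SS>m (\<tau> \<gamma> p)) (ident K k) = actM Q (\<SS>m (\<tau> \<gamma> p')) (ident K k')"
proof -
  obtain g where g: "g \<in> Obj G" "p' = actO P p g"
    using bundle_fiber_torsor[OF P p(1) p'(1)] p p' by auto
  have "actO Q (\<SS>o p) k = actO Q (\<SS>o p) (So g \<otimes>\<^bsub>objG K\<^esub> k')"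
    using same equivariant_obj[OF p(1) g(1)] actO_actO[OF Q \<SS>_obj[OF p(1)] S_obj[OF g(1)] k'] g
    by simp
  moreover have "So g \<otimes>\<^bsub>objG K\<^esub> k' \<in> Obj K"
    using monoid.m_closed[OF group.is_monoid[OF bundle_groups(1)[OF Q]]]
      bundle_groups(2)[OF Q] S_obj[OF g(1)] k' by metis
  ultimately have k_eq: "k = So g \<otimes>\<^bsub>objG K\<^esub> k'"
    using bundle_fiber_torsor[OF Q \<SS>_obj[OF p(1)] actO_closed[OF Q \<SS>_obj[OF p(1)] k]]
      projO_actO[OF Q \<SS>_obj[OF p(1)] k] k by metis
  have "\<SS>m (\<tau> \<gamma> p') = actM Q (\<SS>m (\<tau> \<gamma> p)) (ident K (So g))"
    using \<tau>_act[OF \<gamma> p g(1)] equivariant_mor[OF \<tau>_mor[OF \<gamma> p] ident_in_Mor[OF P g(1)]]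
      S_ident g by simp
  then show ?thesis
    using actM_ident_ident[OF Q \<SS>_mor[OF \<tau>_mor[OF \<gamma> p]] S_obj[OF g(1)] k'] k_eq by simp
qed

abbreviation \<tau>Q where "\<tau>Q \<equiv> pushforward_transport P M Q K \<SS>o \<SS>m \<tau>"

text \<open>
  The transport is defined through one chosen point of the fiber; independence of the lift replaces
  that choice by any pair \<open>(p, k)\<close>, and all later arguments go through this formula.
\<close>

lemma pushforward_transport_eq:
  assumes \<gamma>: "\<gamma> \<in> Mor M" and p: "p \<in> Obj P" "projO P p = src M \<gamma>" and k: "k \<in> Obj K"
  shows "\<tau>Q \<gamma> (actO Q (\<SS>o p) k) = actM Q (\<SS>m (\<tau> \<gamma> p)) (ident K k)"
proof -
  let ?q = "actO Q (\<SS>o p) k"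
  define p0 where "p0 = (SOME p. p \<in> Obj P \<and> projO P p = src M \<gamma>)"
  have p0: "p0 \<in> Obj P" "projO P p0 = src M \<gamma>"
    using someI_ex[of "\<lambda>p. p \<in> Obj P \<and> projO P p = src M \<gamma>"] p unfolding p0_def by blast+
  have "?q \<in> Obj Q" "projO P p0 = projO Q ?q"
    using actO_closed[OF Q \<SS>_obj[OF p(1)] k] projO_actO[OF Q \<SS>_obj[OF p(1)] k]
      over_base[OF p(1)] p p0 by auto
  then have "\<exists>!k. k \<in> Obj K \<and> ?q = actO Q (\<SS>o p0) k"
    by (rule fiber_translation_exists[OF p0(1)])
  from theI'[OF this]
  have k0: "fiber_translation Q K (\<SS>o p0) ?q \<in> Obj K"
    "?q = actO Q (\<SS>o p0) (fiber_translation Q K (\<SS>o p0) ?q)"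
    unfolding fiber_translation_def by blast+
  have "\<tau>Q \<gamma> ?q = actM Q (\<SS>m (\<tau> \<gamma> p0)) (ident K (fiber_translation Q K (\<SS>o p0) ?q))"
    unfolding pushforward_transport_def p0_def Let_def ..
  also have "\<dots> = actM Q (\<SS>m (\<tau> \<gamma> p)) (ident K k)"
    by (rule lift_independent[OF \<gamma> p0 p k0(1) k]) (rule k0(2)[symmetric])
  finally show ?thesis .
qed

lemma fiber_point_exists:
  assumes "q \<in> Obj Q"
  obtains p k where "p \<in> Obj P" "projO P p = projO Q q" "k \<in> Obj K" "q = actO Q (\<SS>o p) k"
proof -
  have "projO Q q \<in> Obj M"
    using bundle_categories(5)[OF Q] assms unfolding is_functor_def by blast
  then obtain p where "p \<in> Obj P" "projO P p = projO Q q"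
    using fiber_nonempty[OF P] by blast
  with fiber_translation_exists[OF this(1) assms this(2)] that show thesis by blast
qed

lemma pushforward_transport_src_tgt:
  assumes \<gamma>: "\<gamma> \<in> Mor M" and p: "p \<in> Obj P" "projO P p = src M \<gamma>" and k: "k \<in> Obj K"
  shows "\<tau>Q \<gamma> (actO Q (\<SS>o p) k) \<in> Mor Q"
    and "src Q (\<tau>Q \<gamma> (actO Q (\<SS>o p) k)) = actO Q (\<SS>o p) k"
    and "tgt Q (\<tau>Q \<gamma> (actO Q (\<SS>o p) k)) = actO Q (\<SS>o (tgt P (\<tau> \<gamma> p))) k"
proof -
  note t = \<tau>_mor[OF \<gamma> p]
  note eq = pushforward_transport_eq[OF assms]
  show "\<tau>Q \<gamma> (actO Q (\<SS>o p) k) \<in> Mor Q"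
    using actM_closed[OF Q \<SS>_mor[OF t] ident_in_Mor[OF Q k]] eq by simp
  show "src Q (\<tau>Q \<gamma> (actO Q (\<SS>o p) k)) = actO Q (\<SS>o p) k"
    using actM_ident_src_tgt(1)[OF Q \<SS>_mor[OF t] k] eq \<SS>_src[OF t] \<tau>_src[OF \<gamma> p] by simp
  show "tgt Q (\<tau>Q \<gamma> (actO Q (\<SS>o p) k)) = actO Q (\<SS>o (tgt P (\<tau> \<gamma> p))) k"
    using actM_ident_src_tgt(2)[OF Q \<SS>_mor[OF t] k] eq \<SS>_tgt[OF t] by simp
qed

lemma pushforward_transport_ident:
  assumes q: "q \<in> Obj Q"
  shows "\<tau>Q (ident M (projO Q q)) q = ident Q q"
proof -
  obtain p k where p: "p \<in> Obj P" "projO P p = projO Q q" and k: "k \<in> Obj K"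
    and q_eq: "q = actO Q (\<SS>o p) k"
    using fiber_point_exists[OF q] .
  have "projO Q q \<in> Obj M"
    using bundle_categories(5)[OF Q] q unfolding is_functor_def by blast
  then have i: "ident M (projO Q q) \<in> Mor M" "src M (ident M (projO Q q)) = projO Q q"
    using bundle_categories(2)[OF Q] unfolding is_category_def by blast+
  have "\<tau>Q (ident M (projO Q q)) q = actM Q (\<SS>m (\<tau> (ident M (projO Q q)) p)) (ident K k)"
    using pushforward_transport_eq[OF i(1) p(1) _ k] p(2) i(2) q_eq by simp
  also have "\<dots> = actM Q (ident Q (\<SS>o p)) (ident K k)"
    using \<tau>_ident[OF p(1)] p \<SS>_ident[OF p(1)] by simp
  also have "\<dots> = ident Q q"
    using actM_ident[OF Q \<SS>_obj[OF p(1)] k] q_eq by simp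
  finally show ?thesis .
qed

text \<open>If \<open>(p, k)\<close> represents \<open>q\<close>, then \<open>(p, k l)\<close> represents \<open>q l\<close>.\<close>

lemma pushforward_transport_act:
  assumes \<gamma>: "\<gamma> \<in> Mor M" and q: "q \<in> Obj Q" "projO Q q = src M \<gamma>" and l: "l \<in> Obj K"
  shows "\<tau>Q \<gamma> (actO Q q l) = actM Q (\<tau>Q \<gamma> q) (ident K l)"
proof -
  obtain p k where p: "p \<in> Obj P" "projO P p = src M \<gamma>" and k: "k \<in> Obj K"
    and q_eq: "q = actO Q (\<SS>o p) k"
    using fiber_point_exists[OF q(1)] q(2) by metis
  have kl: "k \<otimes>\<^bsub>objG K\<^esub> l \<in> Obj K"
    using monoid.m_closed[OF group.is_monoid[OF bundle_groups(1)[OF Q]]]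
      bundle_groups(2)[OF Q] k l by metis
  show ?thesis
    using pushforward_transport_eq[OF \<gamma> p kl] pushforward_transport_eq[OF \<gamma> p k]
      actO_actO[OF Q \<SS>_obj[OF p(1)] k l] actM_ident_ident[OF Q \<SS>_mor[OF \<tau>_mor[OF \<gamma> p]] k l] q_eq
    by simp
qed

text \<open>
  If \<open>(p, k)\<close> represents \<open>q\<close>, then the target of the transport along \<open>\<gamma>\<close> is represented by the target
  of \<open>\<tau>(\<gamma>, p)\<close> with the same \<open>k\<close>, so both factors carry the same \<open>1\<^sub>k\<close> and interchange applies.
\<close>

lemma pushforward_transport_ccomp:
  assumes \<gamma>: "\<gamma> \<in> Mor M" and \<delta>: "\<delta> \<in> Mor M" and \<delta>\<gamma>: "src M \<delta> = tgt M \<gamma>"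
    and q: "q \<in> Obj Q" "projO Q q = src M \<gamma>"
  shows "projO Q (tgt Q (\<tau>Q \<gamma> q)) = src M \<delta>"
    and "\<tau>Q (ccomp M \<delta> \<gamma>) q = ccomp Q (\<tau>Q \<delta> (tgt Q (\<tau>Q \<gamma> q))) (\<tau>Q \<gamma> q)"
proof -
  obtain p k where p: "p \<in> Obj P" "projO P p = src M \<gamma>" and k: "k \<in> Obj K"
    and q_eq: "q = actO Q (\<SS>o p) k"
    using fiber_point_exists[OF q(1)] q(2) by metis
  define p' where "p' = tgt P (\<tau> \<gamma> p)"
  have p': "p' \<in> Obj P" "projO P p' = src M \<delta>"
    using \<tau>_tgt[OF \<gamma> p] \<delta>\<gamma> unfolding p'_def by simp_all
  have tgt_eq: "tgt Q (\<tau>Q \<gamma> q) = actO Q (\<SS>o p') k"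
    using pushforward_transport_src_tgt(3)[OF \<gamma> p k] q_eq unfolding p'_def by simp
  show "projO Q (tgt Q (\<tau>Q \<gamma> q)) = src M \<delta>"
    using tgt_eq projO_actO[OF Q \<SS>_obj[OF p'(1)] k] over_base[OF p'(1)] p'(2) by simp
  have \<delta>\<gamma>_mor: "ccomp M \<delta> \<gamma> \<in> Mor M" "src M (ccomp M \<delta> \<gamma>) = src M \<gamma>"
    using bundle_categories(2)[OF Q] \<gamma> \<delta> \<delta>\<gamma> unfolding is_category_def by blast+
  note t = \<tau>_mor[OF \<gamma> p] and t' = \<tau>_mor[OF \<delta> p']
  have composable: "src P (\<tau> \<delta> p') = tgt P (\<tau> \<gamma> p)"
    using \<tau>_src[OF \<delta> p'] unfolding p'_def by simp
  then have composableQ: "src Q (\<SS>m (\<tau> \<delta> p')) = tgt Q (\<SS>m (\<tau> \<gamma> p))"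
    using \<SS>_src[OF t'] \<SS>_tgt[OF t] by simp
  have "\<tau>Q (ccomp M \<delta> \<gamma>) q = actM Q (\<SS>m (\<tau> (ccomp M \<delta> \<gamma>) p)) (ident K k)"
    using pushforward_transport_eq[OF \<delta>\<gamma>_mor(1) p(1) _ k] p(2) \<delta>\<gamma>_mor(2) q_eq by simp
  also have "\<dots> = actM Q (ccomp Q (\<SS>m (\<tau> \<delta> p')) (\<SS>m (\<tau> \<gamma> p))) (ident K k)"
    using \<tau>_ccomp[OF \<gamma> \<delta> p \<delta>\<gamma>] \<SS>_ccomp[OF t' t composable] unfolding p'_def by simp
  also have "\<dots> = ccomp Q (actM Q (\<SS>m (\<tau> \<delta> p')) (ident K k)) (actM Q (\<SS>m (\<tau> \<gamma> p)) (ident K k))"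
    by (rule actM_ccomp_ident[OF Q \<SS>_mor[OF t'] \<SS>_mor[OF t] composableQ k])
  also have "\<dots> = ccomp Q (\<tau>Q \<delta> (tgt Q (\<tau>Q \<gamma> q))) (\<tau>Q \<gamma> q)"
    using pushforward_transport_eq[OF \<gamma> p k] pushforward_transport_eq[OF \<delta> p' k] tgt_eq q_eq
    by simp
  finally show "\<tau>Q (ccomp M \<delta> \<gamma>) q = ccomp Q (\<tau>Q \<delta> (tgt Q (\<tau>Q \<gamma> q))) (\<tau>Q \<gamma> q)" .
qed

end

theorem proposition4p2p1:
  fixes G :: "('go, 'gm) cat_group"
    and K :: "('ko, 'km) cat_group"
    and M :: "('mo, 'mm) cat_space"
    and P :: "('po, 'pm, 'mo, 'mm, 'go, 'gm) cat_bundle"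
    and Q :: "('qo, 'qm, 'mo, 'mm, 'ko, 'km) cat_bundle"
    and \<SS>o :: "'po \<Rightarrow> 'qo" and \<SS>m :: "'pm \<Rightarrow> 'qm"
    and So :: "'go \<Rightarrow> 'ko" and Sm :: "'gm \<Rightarrow> 'km"
    and \<tau>P :: "'mm \<Rightarrow> 'po \<Rightarrow> 'pm" and \<tau>Q :: "'mm \<Rightarrow> 'qo \<Rightarrow> 'qm"
  assumes "categorical_lie_group G" and "categorical_lie_group K"
    and "categorical_principal_bundle P M G" and "categorical_principal_bundle Q M K"
    and "is_functor P Q \<SS>o \<SS>m" and "is_functor G K So Sm"
    and "\<And>p g. p \<in> Obj P \<Longrightarrow> g \<in> Obj G \<Longrightarrow> \<SS>o (actO P p g) = actO Q (\<SS>o p) (So g)"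
    and "\<And>f \<phi>. f \<in> Mor P \<Longrightarrow> \<phi> \<in> Mor G \<Longrightarrow> \<SS>m (actM P f \<phi>) = actM Q (\<SS>m f) (Sm \<phi>)"
    and "\<And>p. p \<in> Obj P \<Longrightarrow> projO Q (\<SS>o p) = projO P p"
    and "categorical_connection P M G \<tau>P"
    and \<tau>Q: "\<tau>Q = pushforward_transport P M Q K \<SS>o \<SS>m \<tau>P"
  shows
    \<comment> \<open>well-definedness: points \<open>p\<close> in the fiber exist, each determines \<open>k\<close>, and the value
        of \<open>\<tau>Q\<close> is a morphism with source \<open>q\<close> that does not depend on \<open>p\<close>\<close>
    "(\<forall>\<gamma>\<in>Mor M. \<forall>q\<in>Obj Q. projO Q q = src M \<gamma> \<longrightarrow>
        (\<exists>p\<in>Obj P. projO P p = src M \<gamma>) \<and>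
        (\<forall>p\<in>Obj P. projO P p = src M \<gamma> \<longrightarrow>
          (\<exists>!k. k \<in> Obj K \<and> q = actO Q (\<SS>o p) k) \<and>
          (\<forall>k\<in>Obj K. q = actO Q (\<SS>o p) k \<longrightarrow>
             \<tau>Q \<gamma> q = actM Q (\<SS>m (\<tau>P \<gamma> p)) (ident K k))) \<and>
        \<tau>Q \<gamma> q \<in> Mor Q \<and> src Q (\<tau>Q \<gamma> q) = q)
     \<and>
     (\<forall>q\<in>Obj Q. \<tau>Q (ident M (projO Q q)) q = ident Q q)
     \<and>
     (\<forall>\<gamma>\<in>Mor M. \<forall>q\<in>Obj Q. projO Q q = src M \<gamma> \<longrightarrow>
        (\<forall>k\<in>Obj K. \<tau>Q \<gamma> (actO Q q k) = actM Q (\<tau>Q \<gamma> q) (ident K k)))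
     \<and>
     \<comment> \<open>the first conjunct says that the iterated transport is meaningful\<close>
     (\<forall>\<gamma>\<in>Mor M. \<forall>\<delta>\<in>Mor M. \<forall>q\<in>Obj Q. projO Q q = src M \<gamma> \<longrightarrow> src M \<delta> = tgt M \<gamma> \<longrightarrow>
        projO Q (tgt Q (\<tau>Q \<gamma> q)) = src M \<delta> \<and>
        \<tau>Q (ccomp M \<delta> \<gamma>) q = ccomp Q (\<tau>Q \<delta> (tgt Q (\<tau>Q \<gamma> q))) (\<tau>Q \<gamma> q))"
proof -
  interpret connection_pushforward G K M P Q \<SS>o \<SS>m So Sm \<tau>P
    using assms(3-10) by unfold_locales
  show ?thesis
    unfolding \<tau>Q
  proof (intro conjI ballI impI)
    fix \<gamma> q assume \<gamma>: "\<gamma> \<in> Mor M" and q: "q \<in> Obj Q" "projO Q q = src M \<gamma>"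
    obtain p k where pk: "p \<in> Obj P" "projO P p = src M \<gamma>" "k \<in> Obj K" "q = actO Q (\<SS>o p) k"
      using fiber_point_exists[OF q(1)] q(2) by metis
    show "\<exists>p\<in>Obj P. projO P p = src M \<gamma>"
      using pk by blast
    show "pushforward_transport P M Q K \<SS>o \<SS>m \<tau>P \<gamma> q \<in> Mor Q"
      and "src Q (pushforward_transport P M Q K \<SS>o \<SS>m \<tau>P \<gamma> q) = q"
      using pushforward_transport_src_tgt(1,2)[OF \<gamma> pk(1-3)] pk(4) by simp_all
  qed (simp_all add: fiber_translation_exists pushforward_transport_eq pushforward_transport_ident
        pushforward_transport_act pushforward_transport_ccomp)
qed

end
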